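(* The normed hexablock $\mathbb H_N$ is connected but is not an open set in $\mathbb C^4$.
   Context: $\|\cdot\|$ is the operator norm on $M_2(\mathbb C)$ induced by the Euclidean norm on $\mathbb C^2$. $\pi:M_2(\mathbb C)\to\mathbb C^4$ is $\pi((a_{ij}))=(a_{21},a_{11},a_{22},\det(A))$, and the normed hexablock is $\mathbb H_N=\{\pi(A): A\in M_2(\mathbb C),\ \|A\|<1\}$. *)

theory Defs
  imports "HOL-Analysis.Analysis"
begin

text \<open>The library norm on \<^typ>\<open>complex ^ 2\<close> is the Euclidean one. The operator norm has to be
  taken through \<^const>\<open>onorm\<close>: the library's \<^const>\<open>norm\<close> on \<^typ>\<open>complex ^ 2 ^ 2\<close> is the
  Frobenius norm. Entries are \<open>A $ row $ column\<close>.\<close>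

definition opnorm :: "complex ^ 2 ^ 2 \<Rightarrow> real" where
  "opnorm A = onorm (\<lambda>v. A *v v)"

definition hexa_pi :: "complex ^ 2 ^ 2 \<Rightarrow> complex ^ 4" where
  "hexa_pi A = vector [A $ 2 $ 1, A $ 1 $ 1, A $ 2 $ 2, det A]"

definition normed_hexablock :: "(complex ^ 4) set" where
  "normed_hexablock = {hexa_pi A | A. opnorm A < 1}"

end

theory Submission
  imports Defs
begin

text \<open>
  The operator-norm unit ball is convex, hence connected, and \<open>hexa_pi\<close> is continuous because its
  coordinates are polynomials in the matrix entries; so the image of the ball is connected. Openness
  fails at the origin: a matrix whose (2,1) and (1,1) entries vanish has determinant zero,
  whatever its (1,2) entry is. Therefore no point \<open>(0, 0, 0, w)\<close> with \<open>w \<noteq> 0\<close> is a value of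
  \<open>hexa_pi\<close>, although such points lie arbitrarily close to \<open>0 = hexa_pi 0\<close>.
\<close>

lemma hexa_pi_nth:
  "hexa_pi A $ 1 = A $ 2 $ 1" "hexa_pi A $ 2 = A $ 1 $ 1"
  "hexa_pi A $ 3 = A $ 2 $ 2" "hexa_pi A $ 4 = A $ 1 $ 1 * A $ 2 $ 2 - A $ 1 $ 2 * A $ 2 $ 1"
  by (simp_all add: hexa_pi_def vector_def det_2)

lemma continuous_on_hexa_pi: "continuous_on S hexa_pi"
proof -
  have "continuous_on S (\<lambda>A. hexa_pi A $ i)" for i
    using exhaust_4[of i]
    by (elim disjE) (simp_all only: hexa_pi_nth, (intro continuous_intros)+)
  then have "continuous_on S (\<lambda>A. \<chi> i. hexa_pi A $ i)"
    by (rule continuous_on_vec_lambda)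
  then show ?thesis by simp
qed

text \<open>
  Convexity comes from subadditivity and homogeneity of the operator norm, and it gives
  connectedness of the ball in the topology of the Frobenius norm without comparing the two norms.
\<close>

lemma convex_opnorm_ball: "convex {A. opnorm A < r}"
proof (rule convexI, clarsimp)
  fix A B and u v :: real
  assume AB: "opnorm A < r" "opnorm B < r" and uv: "0 \<le> u" "0 \<le> v" "u + v = 1"
  have "(u *\<^sub>R A + v *\<^sub>R B) *v x = u *\<^sub>R (A *v x) + v *\<^sub>R (B *v x)" for x
    by (simp add: matrix_vector_mult_def vec_eq_iff sum.distrib distrib_right scaleR_sum_right)
  then have "opnorm (u *\<^sub>R A + v *\<^sub>R B) = onorm (\<lambda>x. u *\<^sub>R (A *v x) + v *\<^sub>R (B *v x))"
    by (simp add: opnorm_def)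
  also have "\<dots> \<le> onorm (\<lambda>x. u *\<^sub>R (A *v x)) + onorm (\<lambda>x. v *\<^sub>R (B *v x))"
    by (intro onorm_triangle bounded_linear_scaleR_right[THEN bounded_linear_compose]
        matrix_vector_mul_bounded_linear)
  also have "\<dots> = u * opnorm A + v * opnorm B"
    using uv by (simp add: opnorm_def onorm_scaleR)
  also have "\<dots> < r"
    using AB uv by (intro convex_bound_lt)
  finally show "opnorm (u *\<^sub>R A + v *\<^sub>R B) < r" .
qed

theorem theorem4p9:
  shows "connected normed_hexablock \<and> \<not> open normed_hexablock"
proof
  have image: "normed_hexablock = hexa_pi ` {A. opnorm A < 1}"
    by (auto simp: normed_hexablock_def)
  show "connected normed_hexablock"
    unfolding image
    by (intro connected_continuous_image continuous_on_hexa_pi convex_connected convex_opnorm_ball)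
  show "\<not> open normed_hexablock"
  proof
    assume "open normed_hexablock"
    moreover have "opnorm 0 = 0"
      by (simp add: opnorm_def onorm_zero)
    then have "hexa_pi 0 \<in> normed_hexablock"
      by (simp add: image)
    ultimately obtain e where e: "e > 0" "ball (hexa_pi 0) e \<subseteq> normed_hexablock"
      by (meson open_contains_ball)
    \<comment> \<open>Half the radius, so that \<open>p\<close> is nonzero and still inside the ball.\<close>
    define p :: "complex ^ 4" where "p = (e / 2) *\<^sub>R axis 4 1"
    have p_nth: "p $ 1 = 0" "p $ 2 = 0" "p $ 4 = (e / 2) *\<^sub>R 1"
      by (simp_all add: p_def axis_def)
    have "hexa_pi 0 = 0"
      using exhaust_4 by (metis (no_types) hexa_pi_nth vec_eq_iff zero_index mult_zero_left diff_zero)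
    moreover have "norm p = e / 2"
      using e by (simp add: p_def norm_eq_1 inner_axis_axis)
    ultimately have "p \<in> ball (hexa_pi 0) e"
      using e by simp
    then obtain A where "p = hexa_pi A"
      using e image by blast
    then have "p $ 4 = 0"
      using p_nth hexa_pi_nth[of A] by simp
    then show False
      using p_nth e by simp
  qed
qed

end
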